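(* Let $n\ge 1$, $t_f>0$, and for $i=1,\dots,n$ let $\omega_i>0$ and $d_i<0$ be real constants. Let $x_0(0)>x_1(0)>\cdots>x_n(0)$ be real numbers and put $y_i(0)=x_i(0)-x_{i-1}(0)$. Consider the $n$-player noncooperative differential game in which player $i$ ($i=1,\dots,n$) chooses $u_i$ to minimize $$J_i(y_i,u_i)=\frac12\int_0^{t_f}\Big(\omega_i\,(y_i(t)-d_i)^2+u_i(t)^2\Big)\,dt$$ subject to $\dot y_i=u_i$ with the given initial value $y_i(0)$. Then: 1. There is a unique Nash equilibrium of relative displacement control actions $(u_1,\dots,u_n)$. 2. The relative displacement trajectories associated with the Nash equilibrium are, for $i=1,\dots,n$, $$y_i(t)=\alpha_i(t)\,y_i(0)+(\alpha_i(t)-1)\,d_i,\qquad \alpha_i(t)=\frac{\cosh(\sqrt{\omega_i}\,(t_f-t))}{\cosh(\sqrt{\omega_i}\,t_f)}.$$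
   Context: Strategies are open-loop: player $i$'s strategy is a function $u_i\in L^2([0,t_f];\mathbb{R})$, and the corresponding trajectory is $y_i(t)=y_i(0)+\int_0^t u_i(s)\,ds$, $t\in[0,t_f]$. A Nash equilibrium is a profile $(u_1,\dots,u_n)$ such that, for every $i$, no unilateral change of $u_i$ (the other players' controls being kept fixed) yields a smaller value of $J_i$. Uniqueness is understood up to equality almost everywhere. (Interpretation: $x_i$ is the longitudinal position of vehicle $i$ of a platoon, $x_0$ that of a reference, $y_i=x_i-x_{i-1}$ is the relative displacement, and $d_i$ is the inter-vehicle distancing policy.)
   Formalization: The printed trajectory formula has a sign error (it fails e.g. when y_i(0)=d_i, where zero control is optimal); what is proved is y_i(t)=α_i(t) y_i(0)+(1−α_i(t)) d_i in place of α_i(t) y_i(0)+(α_i(t)−1) d_i. *)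

theory Defs
  imports "HOL-Analysis.Analysis"
begin

definition L2_controls :: "real \<Rightarrow> (real \<Rightarrow> real) set" where
  "L2_controls tf = {u. u \<in> borel_measurable (lebesgue_on {0..tf}) \<and>
                        integrable (lebesgue_on {0..tf}) (\<lambda>t. (u t)\<^sup>2)}"

definition trajectory :: "real \<Rightarrow> (real \<Rightarrow> real) \<Rightarrow> real \<Rightarrow> real" where
  "trajectory y0 u t = y0 + (LINT s|lebesgue_on {0..t}. u s)"

definition cost :: "real \<Rightarrow> real \<Rightarrow> real \<Rightarrow> (real \<Rightarrow> real) \<Rightarrow> (real \<Rightarrow> real) \<Rightarrow> real" where
  "cost tf \<omega> d y u = 1/2 * (LINT t|lebesgue_on {0..tf}. \<omega> * (y t - d)\<^sup>2 + (u t)\<^sup>2)"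

(* The players are 1, ..., n; entries of a profile outside {1..n} are irrelevant. *)
definition nash_equilibrium ::
  "nat \<Rightarrow> (nat \<Rightarrow> 's set) \<Rightarrow> (nat \<Rightarrow> (nat \<Rightarrow> 's) \<Rightarrow> real) \<Rightarrow> (nat \<Rightarrow> 's) \<Rightarrow> bool" where
  "nash_equilibrium n S J u \<longleftrightarrow>
     (\<forall>i\<in>{1..n}. u i \<in> S i) \<and>
     (\<forall>i\<in>{1..n}. \<forall>v\<in>S i. J i u \<le> J i (u(i := v)))"

definition platoon_nash ::
  "nat \<Rightarrow> real \<Rightarrow> (nat \<Rightarrow> real) \<Rightarrow> (nat \<Rightarrow> real) \<Rightarrow> (nat \<Rightarrow> real) \<Rightarrow> (nat \<Rightarrow> real \<Rightarrow> real) \<Rightarrow> bool" where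
  "platoon_nash n tf \<omega> d y0 =
     nash_equilibrium n (\<lambda>i. L2_controls tf)
       (\<lambda>i u. cost tf (\<omega> i) (d i) (trajectory (y0 i) (u i)) (u i))"

(* Optimal displacements satisfy y t - d = decay tf \<omega> t * (y 0 - d), so the coefficient of d in the
   closed form of y is 1 - decay. The source prints decay - 1, which fails already for y 0 = d,
   where the zero control is optimal and y is constantly d. *)
definition decay :: "real \<Rightarrow> real \<Rightarrow> real \<Rightarrow> real" where
  "decay tf \<omega> t = cosh (sqrt \<omega> * (tf - t)) / cosh (sqrt \<omega> * tf)"

end

theory Submission
  imports Defs
begin

text \<open>The players' problems are decoupled, so it suffices to minimise each convex quadratic
  functional on its own. The function e = decay * (y 0 - d) solves e'' = \<omega> e with e' = 0 at the
  final time; put w = e'. Perturbing w by h, with displacement H (so H(0) = 0 and H' = h), changes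
  the cost by half the integral of \<omega> H * H + h * h plus the cross term
  \<integral> (\<omega> e H + w h), and the cross term vanishes after integrating by parts (w' = \<omega> e,
  H(0) = 0, w(tf) = 0). Hence w is optimal and every optimal control agrees with it almost everywhere.\<close>

section \<open>Lebesgue integrals over intervals\<close>

lemma integral_lebesgue_on_Int:
  fixes f :: "'a::euclidean_space \<Rightarrow> real"
  assumes "A \<in> sets lebesgue" "B \<in> sets lebesgue"
  shows "(LINT s|lebesgue_on A. indicator B s * f s) = (LINT s|lebesgue_on (A \<inter> B). f s)"
  using assms by (simp add: integral_restrict_space indicator_inter_arith mult.assoc sets.Int)

text \<open>Fubini on the triangle \<open>s \<le> t\<close>. It replaces integration by parts where
  \<open>f\<close> is merely integrable, so that its primitive need not be differentiable
  everywhere.\<close>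

lemma integral_triangle_swap:
  fixes f g :: "real \<Rightarrow> real"
  assumes f: "integrable (lebesgue_on {a..b}) f" and g: "integrable (lebesgue_on {a..b}) g"
  shows "(LINT t|lebesgue_on {a..b}. g t * (LINT s|lebesgue_on {a..t}. f s)) =
         (LINT s|lebesgue_on {a..b}. f s * (LINT t|lebesgue_on {s..b}. g t))"
proof -
  let ?M = "lebesgue_on {a..b}"
  interpret finite_measure ?M
    by (rule finite_measure_lebesgue_on) simp
  interpret P: pair_sigma_finite ?M ?M ..
  \<comment> \<open>The product integrand on the square, cut off to the triangle
    \<open>s \<le> t\<close>.\<close>
  define k where "k s t = indicator {..t} s * (g t * f s)" for s t
  note [measurable] = borel_measurable_integrable[OF f] borel_measurable_integrable[OF g]
  have id[measurable]: "(\<lambda>x. x) \<in> borel_measurable ?M"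
    using id_borel_measurable_lebesgue_on by (simp add: id_def)
  have ind[measurable]: "(\<lambda>p. indicator {..snd p} (fst p) :: real) \<in> borel_measurable (?M \<Otimes>\<^sub>M ?M)"
  proof -
    have "fst \<in> borel_measurable (?M \<Otimes>\<^sub>M ?M)" "snd \<in> borel_measurable (?M \<Otimes>\<^sub>M ?M)"
      using measurable_compose[OF measurable_fst id] measurable_compose[OF measurable_snd id]
      by auto
    have "{p \<in> space (?M \<Otimes>\<^sub>M ?M). fst p \<le> snd p} \<in> sets (?M \<Otimes>\<^sub>M ?M)"
      by (intro borel_measurable_le) fact+
    then have "(\<lambda>p. if fst p \<le> snd p then 1 else 0 :: real) \<in> borel_measurable (?M \<Otimes>\<^sub>M ?M)"
      by (intro measurable_If) simp_all
    also have "(\<lambda>p. if fst p \<le> snd p then 1 else 0 :: real) = (\<lambda>p. indicator {..snd p} (fst p))"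
      by (auto split: split_indicator)
    finally show ?thesis .
  qed
  \<comment> \<open>On the whole square the variables separate, so this product is integrable; it
    dominates \<open>k\<close>.\<close>
  have gf: "integrable (?M \<Otimes>\<^sub>M ?M) (\<lambda>p. g (snd p) * f (fst p))"
  proof (rule P.Fubini_integrable)
    show "integrable ?M (\<lambda>x. LINT y|?M. norm (g (snd (x, y)) * f (fst (x, y))))"
      using f g by (simp add: abs_mult)
    show "AE x in ?M. integrable ?M (\<lambda>y. g (snd (x, y)) * f (fst (x, y)))"
      using g by simp
    show "(\<lambda>p. g (snd p) * f (fst p)) \<in> borel_measurable (?M \<Otimes>\<^sub>M ?M)"
      by measurable
  qed
  have "integrable (?M \<Otimes>\<^sub>M ?M) (case_prod k)"
  proof (rule Bochner_Integration.integrable_bound[OF gf])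
    show "case_prod k \<in> borel_measurable (?M \<Otimes>\<^sub>M ?M)"
      unfolding k_def case_prod_unfold by measurable
  qed (auto simp: k_def split: split_indicator)
  from P.Fubini_integral[OF this]
  have swap: "(LINT t|?M. LINT s|?M. k s t) = (LINT s|?M. LINT t|?M. k s t)" .
  have inner_s: "(LINT s|?M. k s t) = g t * (LINT s|lebesgue_on {a..t}. f s)" if "t \<in> {a..b}" for t
  proof -
    have "(LINT s|?M. indicator {..t} s * f s) = (LINT s|lebesgue_on {a..t}. f s)"
      using integral_lebesgue_on_Int[of "{a..b}" "{..t}" f] that by (simp add: min_absorb2)
    moreover have "(LINT s|?M. k s t) = g t * (LINT s|?M. indicator {..t} s * f s)"
      unfolding integral_mult_right_zero[symmetric] by (simp add: k_def algebra_simps)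
    ultimately show ?thesis
      by simp
  qed
  \<comment> \<open>The triangle sliced the other way: for fixed \<open>s\<close>, the cut-off keeps
    exactly the \<open>t\<close> in \<open>{s..}\<close>.\<close>
  have inner_t: "(LINT t|?M. k s t) = f s * (LINT t|lebesgue_on {s..b}. g t)" if "s \<in> {a..b}" for s
  proof -
    have "(LINT t|?M. indicator {s..} t * g t) = (LINT t|lebesgue_on {s..b}. g t)"
      using integral_lebesgue_on_Int[of "{a..b}" "{s..}" g] that by (simp add: max_absorb2)
    moreover have "(LINT t|?M. k s t) = f s * (LINT t|?M. indicator {s..} t * g t)"
      unfolding integral_mult_right_zero[symmetric]
      by (intro Bochner_Integration.integral_cong) (auto simp: k_def indicator_def)
    ultimately show ?thesis
      by simp
  qed
  have "(LINT t|?M. g t * (LINT s|lebesgue_on {a..t}. f s)) = (LINT t|?M. LINT s|?M. k s t)"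
    by (rule Bochner_Integration.integral_cong) (use inner_s in simp_all)
  also note swap
  also have "(LINT s|?M. LINT t|?M. k s t) = (LINT s|?M. f s * (LINT t|lebesgue_on {s..b}. g t))"
    by (rule Bochner_Integration.integral_cong) (use inner_t in simp_all)
  finally show ?thesis .
qed

lemma integral_FTC_lebesgue_on:
  fixes f f' :: "real \<Rightarrow> real"
  assumes "a \<le> b" and "\<And>x. (f has_real_derivative f' x) (at x)" and "continuous_on UNIV f'"
  shows "(LINT x|lebesgue_on {a..b}. f' x) = f b - f a"
proof -
  have "(f' has_integral (f b - f a)) {a..b}"
    using assms
    by (intro fundamental_theorem_of_calculus)
      (auto intro: has_vector_derivative_at_within simp: has_real_derivative_iff_has_vector_derivative)
  moreover have "integrable (lebesgue_on {a..b}) f'"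
    using assms(3) continuous_on_subset by (blast intro: continuous_imp_integrable_real)
  ultimately show ?thesis
    by (simp add: lebesgue_integral_eq_integral integral_unique)
qed

lemma continuous_on_indefinite_integral:
  fixes f :: "real \<Rightarrow> real"
  assumes "integrable (lebesgue_on {a..b}) f"
  shows "continuous_on {a..b} (\<lambda>t. LINT s|lebesgue_on {a..t}. f s)"
proof -
  have "continuous_on {a..b} (\<lambda>t. integral {a..t} f)"
    using assms by (intro indefinite_integral_continuous_1 integrable_on_lebesgue_on) auto
  moreover have "integral {a..t} f = (LINT s|lebesgue_on {a..t}. f s)" if "t \<in> {a..b}" for t
    using assms that
    by (intro lebesgue_integral_eq_integral[symmetric] integrable_subinterval[OF assms]) auto
  ultimately show ?thesis
    by (rule continuous_on_eq)
qed

section \<open>Square-integrable controls\<close>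

lemma L2_controls_integrable:
  assumes "u \<in> L2_controls tf"
  shows "integrable (lebesgue_on {0..tf}) u"
proof -
  interpret finite_measure "lebesgue_on {0..tf}"
    by (rule finite_measure_lebesgue_on) simp
  \<comment> \<open>Expanding the square of \<open>\<bar>x\<bar> - 1\<close> gives
    \<open>2 * \<bar>x\<bar> \<le> 1 + x\<^sup>2\<close>. The constant 1 is integrable because the
    interval has finite measure.\<close>
  have bound: "norm x \<le> norm (1 + x\<^sup>2)" for x :: real
    using zero_le_power2[of "\<bar>x\<bar> - 1"] by (simp add: power2_diff)
  have "integrable (lebesgue_on {0..tf}) (\<lambda>t. 1 + (u t)\<^sup>2)"
    using assms by (simp add: L2_controls_def)
  moreover have "u \<in> borel_measurable (lebesgue_on {0..tf})"
    using assms by (simp add: L2_controls_def)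
  ultimately show ?thesis
    by (rule Bochner_Integration.integrable_bound) (intro AE_I2 bound)
qed

lemma integrable_mult_L2:
  fixes u v :: "'a \<Rightarrow> real"
  assumes [measurable]: "u \<in> borel_measurable M" "v \<in> borel_measurable M"
    and sq: "integrable M (\<lambda>t. (u t)\<^sup>2)" "integrable M (\<lambda>t. (v t)\<^sup>2)"
  shows "integrable M (\<lambda>t. u t * v t)"
proof (rule Bochner_Integration.integrable_bound)
  show "integrable M (\<lambda>t. (u t)\<^sup>2 + (v t)\<^sup>2)"
    using sq by simp
  have "\<bar>x * y\<bar> \<le> x\<^sup>2 + y\<^sup>2" for x y :: real
  proof -
    \<comment> \<open>The square of \<open>\<bar>x\<bar> - \<bar>y\<bar>\<close> bounds twice the
      product; nonnegativity of the product lets the factor 2 be dropped.\<close>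
    have "0 \<le> \<bar>x\<bar> * \<bar>y\<bar>"
      by simp
    then show ?thesis
      using zero_le_power2[of "\<bar>x\<bar> - \<bar>y\<bar>"]
      unfolding power2_diff abs_mult power2_abs by linarith
  qed
  then show "AE t in M. norm (u t * v t) \<le> norm ((u t)\<^sup>2 + (v t)\<^sup>2)"
    by simp
qed measurable

section \<open>The candidate control\<close>

text \<open>The time derivative of \<open>decay tf \<omega> t * c\<close>, where \<open>c\<close>
  stands for the initial deviation \<open>y0 - d\<close> from the desired distance.\<close>

definition optimal_control :: "real \<Rightarrow> real \<Rightarrow> real \<Rightarrow> real \<Rightarrow> real" where
  "optimal_control tf \<omega> c t = - (sqrt \<omega> * sinh (sqrt \<omega> * (tf - t)) / cosh (sqrt \<omega> * tf)) * c"

lemma decay_0 [simp]: "decay tf \<omega> 0 = 1"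
  by (simp add: decay_def)

text \<open>The transversality condition of a problem with free endpoint: it removes the boundary
  term at the final time.\<close>

lemma optimal_control_final [simp]: "optimal_control tf \<omega> c tf = 0"
  by (simp add: optimal_control_def)

lemma DERIV_decay:
  "((\<lambda>t. decay tf \<omega> t * c) has_real_derivative optimal_control tf \<omega> c t) (at t)"
  unfolding decay_def optimal_control_def
  by (auto intro!: derivative_eq_intros)

lemma DERIV_optimal_control:
  assumes "\<omega> \<ge> 0"
  shows "(optimal_control tf \<omega> c has_real_derivative \<omega> * (decay tf \<omega> t * c)) (at t)"
proof -
  \<comment> \<open>Each differentiation brings out one factor \<open>sqrt \<omega>\<close>; their
    product is \<omega> since \<omega> is nonnegative. This is the Euler-Lagrange equation.\<close>
  have "(optimal_control tf \<omega> c has_real_derivative (sqrt \<omega> * sqrt \<omega>) * (decay tf \<omega> t * c)) (at t)"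
    unfolding decay_def optimal_control_def
    by (rule derivative_eq_intros refl | simp)+
  then show ?thesis
    using assms by simp
qed

lemma continuous_on_decay: "continuous_on A (decay tf \<omega>)"
  unfolding decay_def by (intro continuous_intros) auto

lemma continuous_on_optimal_control: "continuous_on A (optimal_control tf \<omega> c)"
  unfolding optimal_control_def by (intro continuous_intros) auto

lemma optimal_control_L2: "optimal_control tf \<omega> c \<in> L2_controls tf"
proof -
  have "continuous_on {0..tf} (\<lambda>t. (optimal_control tf \<omega> c t)\<^sup>2)"
    by (intro continuous_on_power continuous_on_optimal_control)
  then show ?thesis
    by (simp add: L2_controls_def continuous_imp_integrable_real
        continuous_imp_measurable_on_sets_lebesgue continuous_on_optimal_control)
qed

lemma trajectory_optimal_control:
  assumes "t \<ge> 0"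
  shows "trajectory y0 (optimal_control tf \<omega> (y0 - d)) t =
    decay tf \<omega> t * y0 + (1 - decay tf \<omega> t) * d"
  using integral_FTC_lebesgue_on[OF assms DERIV_decay continuous_on_optimal_control, of tf \<omega> "y0 - d"]
  by (simp add: trajectory_def algebra_simps)

section \<open>Expansion of the cost around the candidate\<close>

text \<open>After the swap on the triangle, the inner integral runs over the derivative of the
  candidate control from \<open>s\<close> to \<open>tf\<close>, and only the value at
  \<open>s\<close> survives.\<close>

lemma cost_cross_term:
  assumes "\<omega> \<ge> 0" and h: "integrable (lebesgue_on {0..tf}) h"
  shows "(LINT t|lebesgue_on {0..tf}. \<omega> * (decay tf \<omega> t * c) * (LINT s|lebesgue_on {0..t}. h s)) =
    - (LINT t|lebesgue_on {0..tf}. h t * optimal_control tf \<omega> c t)"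
proof -
  have cont: "continuous_on A (\<lambda>t. \<omega> * (decay tf \<omega> t * c))" for A
    by (intro continuous_intros continuous_on_decay)
  have "(LINT t|lebesgue_on {s..tf}. \<omega> * (decay tf \<omega> t * c)) = - optimal_control tf \<omega> c s"
    if "s \<in> {0..tf}" for s
    using that integral_FTC_lebesgue_on[OF _ DERIV_optimal_control[OF assms(1)] cont, of s tf] by simp
  then have "(LINT s|lebesgue_on {0..tf}. h s * (LINT t|lebesgue_on {s..tf}. \<omega> * (decay tf \<omega> t * c))) =
      (LINT s|lebesgue_on {0..tf}. - (h s * optimal_control tf \<omega> c s))"
    by (intro Bochner_Integration.integral_cong) auto
  then show ?thesis
    using integral_triangle_swap[OF h continuous_imp_integrable_real[OF cont]]
    by simp
qed

text \<open>The cost is quadratic and the first variation at \<open>w\<close> vanishes, so the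
  excess cost of \<open>u\<close> is exactly half the integral of the quadratic form
  \<open>Q\<close> of the difference. Minimality and uniqueness both follow from this
  identity.\<close>

lemma cost_expansion:
  fixes u :: "real \<Rightarrow> real" and tf \<omega> y0 d :: real
  defines "w \<equiv> optimal_control tf \<omega> (y0 - d)"
  defines "Q \<equiv> \<lambda>t. \<omega> * (LINT s|lebesgue_on {0..t}. u s - w s)\<^sup>2 + (u t - w t)\<^sup>2"
  assumes \<omega>: "\<omega> \<ge> 0" and u: "u \<in> L2_controls tf"
  shows "integrable (lebesgue_on {0..tf}) Q"
    and "cost tf \<omega> d (trajectory y0 u) u =
      cost tf \<omega> d (trajectory y0 w) w + 1/2 * (LINT t|lebesgue_on {0..tf}. Q t)"
proof -
  let ?M = "lebesgue_on {0..tf}"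
  define h where "h t = u t - w t" for t
  define H where "H t = (LINT s|lebesgue_on {0..t}. h s)" for t
  define e where "e t = decay tf \<omega> t * (y0 - d)" for t
  have w: "w \<in> L2_controls tf"
    unfolding w_def by (rule optimal_control_L2)
  have iu: "integrable ?M u" and iw: "integrable ?M w"
    using u w by (auto intro: L2_controls_integrable)
  then have ih: "integrable ?M h"
    unfolding h_def by simp
  have uw: "integrable ?M (\<lambda>t. u t * w t)"
    using u w by (auto simp: L2_controls_def intro: integrable_mult_L2)
  have u2: "integrable ?M (\<lambda>t. (u t)\<^sup>2)" and w2: "integrable ?M (\<lambda>t. (w t)\<^sup>2)"
    using u w by (auto simp: L2_controls_def)
  have "integrable ?M (\<lambda>t. (u t)\<^sup>2 + (w t)\<^sup>2 - 2 * (u t * w t))"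
    using u2 w2 uw by simp
  then have h2: "integrable ?M (\<lambda>t. (h t)\<^sup>2)"
    by (simp add: h_def power2_diff mult.assoc)
  have "integrable ?M (\<lambda>t. u t * w t - (w t)\<^sup>2)"
    using w2 uw by simp
  then have hw: "integrable ?M (\<lambda>t. h t * w t)"
    by (simp add: h_def algebra_simps power2_eq_square)
  have H: "continuous_on {0..tf} H"
    unfolding H_def by (rule continuous_on_indefinite_integral[OF ih])
  have e: "continuous_on {0..tf} e"
    unfolding e_def by (intro continuous_intros continuous_on_decay)
  \<comment> \<open>\<open>H\<close> and \<open>e\<close> are continuous on a compact interval,
    which makes these terms integrable and lets the integral be split below.\<close>
  have iH: "integrable ?M (\<lambda>t. \<omega> * (H t)\<^sup>2)" "integrable ?M (\<lambda>t. \<omega> * (e t)\<^sup>2)"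
    "integrable ?M (\<lambda>t. \<omega> * e t * H t)"
    using H e by (auto intro!: continuous_imp_integrable_real continuous_intros)
  have Q: "Q t = \<omega> * (H t)\<^sup>2 + (h t)\<^sup>2" for t
    by (simp add: Q_def H_def h_def)
  show iQ: "integrable ?M Q"
    unfolding Q[abs_def] by (intro Bochner_Integration.integrable_add iH h2)
  have tw: "trajectory y0 w t - d = e t" if "t \<in> {0..tf}" for t
    using that trajectory_optimal_control[of t y0 tf \<omega> d] by (simp add: w_def e_def algebra_simps)
  have tu: "trajectory y0 u t - d = e t + H t" if t: "t \<in> {0..tf}" for t
  proof -
    have "integrable (lebesgue_on {0..t}) u" "integrable (lebesgue_on {0..t}) w"
      using t by (auto intro: integrable_subinterval[OF iu] integrable_subinterval[OF iw])
    then have "trajectory y0 u t = trajectory y0 w t + H t"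
      by (simp add: trajectory_def H_def h_def)
    then show ?thesis
      using tw[OF t] by simp
  qed
  \<comment> \<open>The first variation of the cost at \<open>w\<close> in direction
    \<open>h\<close>.\<close>
  have cross: "(LINT t|?M. \<omega> * e t * H t) + (LINT t|?M. h t * w t) = 0"
    using cost_cross_term[OF \<omega> ih, of "y0 - d"] by (simp add: e_def H_def w_def)
  \<comment> \<open>Here the deviation is \<open>e + H\<close> and the control is
    \<open>w + h\<close>; both squares are expanded and the mixed terms collected.\<close>
  have "(LINT t|?M. \<omega> * (trajectory y0 u t - d)\<^sup>2 + (u t)\<^sup>2) =
    (LINT t|?M. (\<omega> * (e t)\<^sup>2 + (w t)\<^sup>2) + Q t + 2 * (\<omega> * e t * H t + h t * w t))"
    by (intro Bochner_Integration.integral_cong)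
      (auto simp: tu Q h_def power2_eq_square algebra_simps)
  also have "\<dots> = (LINT t|?M. \<omega> * (e t)\<^sup>2 + (w t)\<^sup>2) + (LINT t|?M. Q t)
      + 2 * ((LINT t|?M. \<omega> * e t * H t) + (LINT t|?M. h t * w t))"
    using iH w2 iQ hw by simp
  also have "(LINT t|?M. \<omega> * (e t)\<^sup>2 + (w t)\<^sup>2) =
      (LINT t|?M. \<omega> * (trajectory y0 w t - d)\<^sup>2 + (w t)\<^sup>2)"
    by (intro Bochner_Integration.integral_cong) (auto simp: tw)
  finally show "cost tf \<omega> d (trajectory y0 u) u =
      cost tf \<omega> d (trajectory y0 w) w + 1/2 * (LINT t|lebesgue_on {0..tf}. Q t)"
    unfolding cost_def cross by simp
qed

lemma optimal_control_minimal:
  assumes "\<omega> \<ge> 0" and "u \<in> L2_controls tf"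
  shows "cost tf \<omega> d (trajectory y0 (optimal_control tf \<omega> (y0 - d))) (optimal_control tf \<omega> (y0 - d))
    \<le> cost tf \<omega> d (trajectory y0 u) u"
  using assms by (simp add: cost_expansion(2) integral_nonneg_AE)

text \<open>A control that costs no more than the candidate forces the nonnegative \<open>Q\<close>
  to have integral 0, hence to vanish almost everywhere; its summand in the controls then vanishes
  too.\<close>

lemma optimal_control_unique:
  assumes "\<omega> \<ge> 0" and "u \<in> L2_controls tf"
    and le: "cost tf \<omega> d (trajectory y0 u) u \<le>
      cost tf \<omega> d (trajectory y0 (optimal_control tf \<omega> (y0 - d))) (optimal_control tf \<omega> (y0 - d))"
  shows "AE t in lebesgue_on {0..tf}. u t = optimal_control tf \<omega> (y0 - d) t"
proof -
  let ?w = "optimal_control tf \<omega> (y0 - d)"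
  define Q where "Q t = \<omega> * (LINT s|lebesgue_on {0..t}. u s - ?w s)\<^sup>2 + (u t - ?w t)\<^sup>2" for t
  have Q: "0 \<le> Q t" for t
    using assms(1) by (simp add: Q_def)
  have "(LINT t|lebesgue_on {0..tf}. Q t) \<le> 0"
    using le cost_expansion(2)[OF assms(1,2), of d y0] by (simp add: Q_def)
  then have "(LINT t|lebesgue_on {0..tf}. Q t) = 0"
    using Q by (simp add: antisym integral_nonneg_AE)
  moreover have "integrable (lebesgue_on {0..tf}) Q"
    using cost_expansion(1)[OF assms(1,2), of y0 d] by (simp add: Q_def[abs_def])
  ultimately have "AE t in lebesgue_on {0..tf}. Q t = 0"
    using Q integral_nonneg_eq_0_iff_AE[of "lebesgue_on {0..tf}" Q] by simp
  then show ?thesis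
  proof eventually_elim
    case (elim t)
    moreover have "0 \<le> \<omega> * (LINT s|lebesgue_on {0..t}. u s - ?w s)\<^sup>2"
      using assms(1) by simp
    ultimately have "(u t - ?w t)\<^sup>2 \<le> 0"
      unfolding Q_def by linarith
    then show ?case
      by simp
  qed
qed

section \<open>Equilibria of the game\<close>

text \<open>Integration ignores null sets, so agreement of controls almost everywhere becomes
  agreement of displacements at every time.\<close>

lemma trajectory_cong_AE:
  assumes u: "u \<in> L2_controls tf" and w: "w \<in> L2_controls tf"
    and eq: "AE t in lebesgue_on {0..tf}. u t = w t" and t: "t \<in> {0..tf}"
  shows "trajectory y0 u t = trajectory y0 w t"
proof -
  have "AE s in lebesgue_on {0..t}. u s = w s"
    using eq t by (auto simp: AE_restrict_space_iff elim: eventually_mono)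
  moreover have "integrable (lebesgue_on {0..t}) u" "integrable (lebesgue_on {0..t}) w"
    using t by (auto intro: integrable_subinterval[OF L2_controls_integrable[OF u]]
        integrable_subinterval[OF L2_controls_integrable[OF w]])
  ultimately show ?thesis
    unfolding trajectory_def by (auto intro!: integral_cong_AE)
qed

theorem theorem1:
  fixes n :: nat and tf :: real and \<omega> d x_init y_init :: "nat \<Rightarrow> real"
  assumes "n \<ge> 1" and "tf > 0"
    and "\<And>i. i \<in> {1..n} \<Longrightarrow> \<omega> i > 0"
    and "\<And>i. i \<in> {1..n} \<Longrightarrow> d i < 0"
    and "\<And>i. i \<in> {1..n} \<Longrightarrow> x_init (i - 1) > x_init i"
    and "\<And>i. i \<in> {1..n} \<Longrightarrow> y_init i = x_init i - x_init (i - 1)"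
  shows "(\<exists>u. platoon_nash n tf \<omega> d y_init u \<and>
            (\<forall>v. platoon_nash n tf \<omega> d y_init v \<longrightarrow>
                 (\<forall>i\<in>{1..n}. AE t in lebesgue_on {0..tf}. v i t = u i t))) \<and>
         (\<forall>u. platoon_nash n tf \<omega> d y_init u \<longrightarrow>
            (\<forall>i\<in>{1..n}. \<forall>t\<in>{0..tf}.
               trajectory (y_init i) (u i) t =
                 decay tf (\<omega> i) t * y_init i + (1 - decay tf (\<omega> i) t) * d i))"
proof -
  define w where "w i = optimal_control tf (\<omega> i) (y_init i - d i)" for i
  have \<omega>: "\<omega> i \<ge> 0" if "i \<in> {1..n}" for i
    using assms(3)[OF that] by simp
  have wL2: "w i \<in> L2_controls tf" for i
    unfolding w_def by (rule optimal_control_L2)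
  \<comment> \<open>Player \<open>i\<close>'s cost involves only its own control, so individually
    optimal controls form an equilibrium.\<close>
  have nash: "platoon_nash n tf \<omega> d y_init w"
    unfolding platoon_nash_def nash_equilibrium_def
    using \<omega> wL2 by (simp add: w_def optimal_control_minimal)
  have unique: "AE t in lebesgue_on {0..tf}. v i t = w i t" and vL2: "v i \<in> L2_controls tf"
    if v: "platoon_nash n tf \<omega> d y_init v" and i: "i \<in> {1..n}" for v i
  proof -
    show "v i \<in> L2_controls tf"
      using v i by (auto simp: platoon_nash_def nash_equilibrium_def)
    \<comment> \<open>The equilibrium condition is tested against the single deviation
      \<open>v(i := w i)\<close>.\<close>
    moreover have "cost tf (\<omega> i) (d i) (trajectory (y_init i) (v i)) (v i)
        \<le> cost tf (\<omega> i) (d i) (trajectory (y_init i) (w i)) (w i)"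
      using v i wL2[of i] unfolding platoon_nash_def nash_equilibrium_def
      by (metis fun_upd_same)
    ultimately show "AE t in lebesgue_on {0..tf}. v i t = w i t"
      unfolding w_def by (intro optimal_control_unique \<omega> i)
  qed
  \<comment> \<open>The closed form is known for \<open>w\<close>; uniqueness carries it over to any
    equilibrium \<open>u\<close>.\<close>
  have "trajectory (y_init i) (u i) t =
      decay tf (\<omega> i) t * y_init i + (1 - decay tf (\<omega> i) t) * d i"
    if u: "platoon_nash n tf \<omega> d y_init u" and i: "i \<in> {1..n}" and t: "t \<in> {0..tf}" for u i t
    using trajectory_cong_AE[OF vL2[OF u i] wL2 unique[OF u i] t] t
    by (simp add: w_def trajectory_optimal_control)
  then show ?thesis
    using nash unique by blast
qed

end
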